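(* Let $k \ge 2$ and assume the satisfiability threshold conjecture holds for $k$, i.e. there is a constant $\alpha_k$ such that $\lim_{n\to\infty}\Pr[F_k(n,\lfloor\alpha n\rfloor)\text{ is satisfiable}]$ equals $1$ for every $\alpha < \alpha_k$ and equals $0$ for every $\alpha > \alpha_k$. Then there exist a density $\alpha < \alpha_k$ and an on-line strategy for the $t=2$ choice $k$-SAT Achlioptas process such that, with $m = \lfloor \alpha n \rfloor$, the formula produced by the strategy is unsatisfiable with probability tending to $1$ as $n \to \infty$.
   Context: Fix $n$ Boolean variables $x_1,\dots,x_n$. A $k$-clause is a disjunction of $k$ literals on $k$ distinct variables; there are $2^k\binom{n}{k}$ of them. The random formula $F_k(n,m)$ is the conjunction of $m$ clauses, each chosen independently and uniformly from these $2^k\binom{n}{k}$ clauses. In the $t$-choice Achlioptas process for $k$-SAT, for each step $i = 1,\dots,m$ one is presented with $t$ independent, uniformly random $k$-clauses; a strategy selects one of them (its choice may depend on all clauses presented and selected at earlier steps and on the current $t$ clauses, but not on future ones) and adds it to the formula, discarding the others. After $m$ steps the result is a $k$-SAT formula with $m$ clauses on the variables $x_1,\dots,x_n$. *)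

theory Defs
  imports "HOL-Probability.Probability"
begin

text \<open>The literal \<open>(v, b)\<close> on variable \<open>v\<close> is true under an assignment \<open>\<tau>\<close> iff \<open>\<tau> v = b\<close>,
  i.e. \<open>b\<close> is the sign of the literal. The variables of an \<open>n\<close>-variable formula are \<open>0, \<dots>, n - 1\<close>.\<close>

type_synonym literal = "nat \<times> bool"
type_synonym clause = "literal set"
type_synonym cnf = "clause list"

text \<open>Injectivity of \<^const>\<open>fst\<close> says that the \<open>k\<close> literals are on distinct variables.\<close>

definition k_clauses :: "nat \<Rightarrow> nat \<Rightarrow> clause set" where
  "k_clauses k n = {C. C \<subseteq> {..<n} \<times> UNIV \<and> card C = k \<and> inj_on fst C}"

definition satisfiable :: "cnf \<Rightarrow> bool" where
  "satisfiable F \<longleftrightarrow> (\<exists>\<tau> :: nat \<Rightarrow> bool. \<forall>C\<in>set F. \<exists>(v, b)\<in>C. \<tau> v = b)"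

text \<open>For \<open>n < k\<close> there are no \<open>k\<close>-clauses and the following distribution is unspecified; only
  limits \<open>n \<rightarrow> \<infinity>\<close> are taken below.\<close>

definition random_clause :: "nat \<Rightarrow> nat \<Rightarrow> clause pmf" where
  "random_clause k n = pmf_of_set (k_clauses k n)"

definition random_formula :: "nat \<Rightarrow> nat \<Rightarrow> nat \<Rightarrow> cnf pmf" where
  "random_formula k n m = replicate_pmf m (random_clause k n)"

definition is_sat_threshold :: "nat \<Rightarrow> real \<Rightarrow> bool" where
  "is_sat_threshold k \<alpha>\<^sub>k \<longleftrightarrow>
     (\<forall>\<alpha>\<ge>0. \<alpha> < \<alpha>\<^sub>k \<longrightarrow>
        (\<lambda>n. measure_pmf.prob (random_formula k n (nat \<lfloor>\<alpha> * real n\<rfloor>)) {F. satisfiable F})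
          \<longlonglongrightarrow> 1) \<and>
     (\<forall>\<alpha>\<ge>0. \<alpha> > \<alpha>\<^sub>k \<longrightarrow>
        (\<lambda>n. measure_pmf.prob (random_formula k n (nat \<lfloor>\<alpha> * real n\<rfloor>)) {F. satisfiable F})
          \<longlonglongrightarrow> 0)"

text \<open>A history records, for each past step in chronological order, the presented clauses and the
  selected one. A strategy maps the history and the currently presented clauses to its selection,
  so being on-line is built into its type.\<close>

type_synonym history = "(clause list \<times> clause) list"
type_synonym strategy = "history \<Rightarrow> clause list \<Rightarrow> clause"

definition is_strategy :: "nat \<Rightarrow> strategy \<Rightarrow> bool" where
  "is_strategy t \<sigma> \<longleftrightarrow> (\<forall>h cs. length cs = t \<longrightarrow> \<sigma> h cs \<in> set cs)"

primrec achlioptas_process :: "nat \<Rightarrow> nat \<Rightarrow> nat \<Rightarrow> strategy \<Rightarrow> nat \<Rightarrow> history pmf" where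
  "achlioptas_process t k n \<sigma> 0 = return_pmf []"
| "achlioptas_process t k n \<sigma> (Suc i) =
     bind_pmf (achlioptas_process t k n \<sigma> i) (\<lambda>h.
       map_pmf (\<lambda>cs. h @ [(cs, \<sigma> h cs)]) (replicate_pmf t (random_clause k n)))"

definition achlioptas_formula :: "nat \<Rightarrow> nat \<Rightarrow> nat \<Rightarrow> strategy \<Rightarrow> nat \<Rightarrow> cnf pmf" where
  "achlioptas_formula t k n \<sigma> m = map_pmf (map snd) (achlioptas_process t k n \<sigma> m)"

end

theory Submission
  imports Defs "HOL-Real_Asymp.Real_Asymp"
begin

text \<open>
  The strategy fixes a set of \<open>\<lfloor>b n\<rfloor>\<close> variables and selects the first clause if all its variables
  are in this set, and otherwise the second. The selected clauses inside the set are independent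
  and uniform, and their density relative to \<open>b n\<close> is the original density multiplied by
  \<open>(1 - (1 - b\<^sup>k)\<^sup>2) / b = 2 b\<^bsup>k - 1\<^esup> - b\<^bsup>2 k - 1\<^esup>\<close>. At \<open>b = 1\<close> this factor is \<open>1\<close> with derivative \<open>-1\<close>,
  so it exceeds \<open>1\<close> for \<open>b\<close> slightly below \<open>1\<close>. Hence some density below the threshold is pushed
  above the threshold of the random formula on the preferred variables.
  This needs a positive threshold, which follows from a first moment bound over unsatisfiable cores.
\<close>


section \<open>Counting clauses and binomial tails\<close>

text \<open>An arbitrary set of variables is allowed, since the clauses inside a candidate core
  \<open>W\<close> have to be counted as well as those on an initial segment.\<close>

definition clauses_over :: "nat \<Rightarrow> nat set \<Rightarrow> clause set" where
  "clauses_over k V = {C. C \<subseteq> V \<times> UNIV \<and> card C = k \<and> inj_on fst C}"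

lemma k_clauses_eq: "k_clauses k n = clauses_over k {..<n}"
  by (simp add: k_clauses_def clauses_over_def)

lemma finite_clauses_over: "finite V \<Longrightarrow> finite (clauses_over k V)"
  by (rule finite_subset[of _ "Pow (V \<times> UNIV)"]) (auto simp: clauses_over_def)

text \<open>A clause corresponds to the set \<open>W\<close> of its variables together with the set
  \<open>P\<close> of those that occur positively: there are \<open>card V choose k\<close> choices
  of \<open>W\<close>, each with \<open>2 ^ k\<close> choices of \<open>P\<close>.\<close>

lemma card_clauses_over:
  assumes "finite V"
  shows "card (clauses_over k V) = 2 ^ k * (card V choose k)"
proof -
  let ?S = "SIGMA W:{W. W \<subseteq> V \<and> card W = k}. Pow W"
  let ?f = "\<lambda>(W, P). (\<lambda>v. (v, v \<in> P)) ` W"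
  let ?g = "\<lambda>C. (fst ` C, {v. (v, True) \<in> C})"
  have "bij_betw ?f ?S (clauses_over k V)"
  proof (rule bij_betwI[where g = ?g])
    show "?f \<in> ?S \<rightarrow> clauses_over k V"
      by (auto simp: clauses_over_def card_image inj_on_def)
    show "?g \<in> clauses_over k V \<rightarrow> ?S"
      by (auto simp: clauses_over_def card_image) (force)
    show "?g (?f x) = x" if "x \<in> ?S" for x
      using that by (auto simp: image_image)
    show "?f (?g C) = C" if "C \<in> clauses_over k V" for C
    proof -
      \<comment> \<open>No variable occurs twice in \<open>C\<close>, so the sign of
        \<open>v\<close> can be read off from whether the positive literal on \<open>v\<close>
        belongs to \<open>C\<close>.\<close>
      have inj: "inj_on fst C"
        using that by (simp add: clauses_over_def)
      have "((v, True) \<in> C) = b" if "(v, b) \<in> C" for v b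
        using inj_onD[OF inj, of "(v, b)" "(v, True)"] that by (cases b) auto
      then show ?thesis
        by (force simp: image_image)
    qed
  qed
  then have "card (clauses_over k V) = card ?S"
    by (simp add: bij_betw_same_card)
  also have "\<dots> = (\<Sum>W | W \<subseteq> V \<and> card W = k. card (Pow W))"
    using assms by (intro card_SigmaI) (auto intro: finite_subset)
  also have "\<dots> = (\<Sum>W | W \<subseteq> V \<and> card W = k. 2 ^ k)"
    using assms by (intro sum.cong) (auto simp: card_Pow finite_subset)
  finally show ?thesis
    using assms by (simp add: n_subsets)
qed

lemma k_clauses_nonempty: "k \<le> n \<Longrightarrow> k_clauses k n \<noteq> {}"
  using card_clauses_over[of "{..<n}" k] by (auto simp: k_clauses_eq)

lemma finite_k_clauses: "finite (k_clauses k n)"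
  by (simp add: k_clauses_eq finite_clauses_over)

lemma set_random_clause: "k \<le> n \<Longrightarrow> set_pmf (random_clause k n) = k_clauses k n"
  by (simp add: random_clause_def k_clauses_nonempty finite_k_clauses)

lemma prob_random_clause_over:
  assumes "k \<le> n" "W \<subseteq> {..<n}"
  shows "measure_pmf.prob (random_clause k n) {C. C \<subseteq> W \<times> UNIV} = (card W choose k) / (n choose k)"
proof -
  have "k_clauses k n \<inter> {C. C \<subseteq> W \<times> UNIV} = clauses_over k W"
    using assms(2) by (auto simp: k_clauses_def clauses_over_def)
  moreover have "finite W"
    using assms(2) finite_subset by blast
  ultimately show ?thesis
    using assms(1)
    by (simp add: random_clause_def measure_pmf_of_set k_clauses_nonempty finite_k_clauses
        card_clauses_over) (simp add: k_clauses_eq card_clauses_over)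
qed

lemma choose_ratio_eq_prod:
  assumes "k \<le> v" "v \<le> n"
  shows "real (v choose k) / real (n choose k) = (\<Prod>i<k. real (v - i) / real (n - i))"
proof -
  have "real (v choose k) / real (n choose k)
      = (\<Prod>i<k. (real (v - i) / real (k - i)) / (real (n - i) / real (k - i)))"
    using assms by (simp add: binomial_altdef_of_nat prod_dividef atLeast0LessThan)
  also have "\<dots> = (\<Prod>i<k. real (v - i) / real (n - i))"
    by (intro prod.cong) auto
  finally show ?thesis .
qed

text \<open>Each factor \<open>(v - i) / (n - i)\<close> of the product form is at most
  \<open>v / n\<close>. For \<open>k > v\<close> the left side is zero.\<close>

lemma choose_ratio_le:
  assumes "v \<le> n"
  shows "real (v choose k) / real (n choose k) \<le> (real v / real n) ^ k"
proof (cases "k \<le> v")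
  case True
  have "(\<Prod>i<k. real (v - i) / real (n - i)) \<le> (\<Prod>i<k. real v / real n)"
  proof (rule prod_mono, safe)
    fix i assume "i < k"
    then show "real (v - i) / real (n - i) \<le> real v / real n"
      using assms True mult_left_mono[of "real v" "real n" "real i"]
      by (simp add: of_nat_diff field_simps)
  qed simp
  then show ?thesis
    using choose_ratio_eq_prod[OF True assms] by simp
qed (simp add: not_le binomial_eq_0)

section \<open>Independent samples and exponential bounds\<close>

lemma map_replicate_pmf:
  "map_pmf (map f) (replicate_pmf n p) = replicate_pmf n (map_pmf f p)"
proof (induction n)
  case (Suc n)
  have "map_pmf (map f) (replicate_pmf (Suc n) p)
      = bind_pmf p (\<lambda>x. bind_pmf (map_pmf (map f) (replicate_pmf n p)) (\<lambda>ys. return_pmf (f x # ys)))"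
    by (simp add: map_bind_pmf bind_map_pmf)
  then show ?case
    by (simp add: Suc.IH bind_map_pmf)
qed simp

lemma map_pmf_eq_bernoulli:
  "map_pmf P M = bernoulli_pmf (measure_pmf.prob M {x. P x})"
proof (rule pmf_eqI)
  fix b
  have "P -` {False} = UNIV - {x. P x}" "P -` {True} = {x. P x}"
    by auto
  then show "pmf (map_pmf P M) b = pmf (bernoulli_pmf (measure_pmf.prob M {x. P x})) b"
    using measure_pmf.prob_compl[of "{x. P x}" M] by (cases b) (simp_all add: pmf_map)
qed

text \<open>Applying \<open>P\<close> to each sample yields independent Bernoulli variables, and the
  binomial law counts the successes among them.\<close>

lemma length_filter_replicate_pmf:
  "map_pmf (\<lambda>xs. length (filter P xs)) (replicate_pmf n M)
     = binomial_pmf n (measure_pmf.prob M {x. P x})"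
proof -
  have "length (filter P xs) = length (filter id (map P xs))" for xs
    by (simp add: filter_map)
  then have "map_pmf (\<lambda>xs. length (filter P xs)) (replicate_pmf n M)
      = map_pmf (length \<circ> filter id) (map_pmf (map P) (replicate_pmf n M))"
    by (simp add: map_pmf_comp o_def)
  also have "\<dots> = map_pmf (length \<circ> filter id)
      (replicate_pmf n (bernoulli_pmf (measure_pmf.prob M {x. P x})))"
    by (simp only: map_replicate_pmf map_pmf_eq_bernoulli)
  finally show ?thesis
    by (simp add: binomial_pmf_altdef)
qed

text \<open>Markov's inequality for \<open>l ^ X\<close> with \<open>X\<close> binomial, whose
  expectation is \<open>(q * l + (1 - q)) ^ m\<close>. The parameter \<open>l\<close> stays free and
  is tuned in the core bound.\<close>

lemma binomial_pmf_tail_le: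
  fixes l q :: real
  assumes "0 \<le> q" "q \<le> 1" "1 \<le> l"
  shows "measure_pmf.prob (binomial_pmf m q) {s..} \<le> exp (q * l * m) / l ^ s"
proof -
  have "measure_pmf.prob (binomial_pmf m q) {s..} * l ^ s
      = measure_pmf.expectation (binomial_pmf m q) (\<lambda>j. indicator {s..} j * l ^ s)"
    by simp
  also have "\<dots> \<le> measure_pmf.expectation (binomial_pmf m q) (\<lambda>j. l ^ j)"
    using assms by (intro integral_mono) (auto simp: indicator_def intro: power_increasing)
  also have "\<dots> = (\<Sum>j\<le>m. real (m choose j) * (q * l) ^ j * (1 - q) ^ (m - j))"
    using assms by (simp add: expectation_binomial_pmf' power_mult_distrib mult_ac)
  also have "\<dots> = (q * l + (1 - q)) ^ m"
    by (subst binomial_ring) simp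
  also have "\<dots> \<le> exp (q * l) ^ m"
  proof (rule power_mono)
    show "q * l + (1 - q) \<le> exp (q * l)"
      using assms(1) exp_ge_add_one_self[of "q * l"] by linarith
  qed (use assms in simp)
  also have "\<dots> = exp (q * l * m)"
    by (simp add: exp_of_nat_mult[symmetric] mult_ac)
  finally show ?thesis
    using assms by (simp add: field_simps)
qed

text \<open>The term of index \<open>v\<close> in the expansion of \<open>(1 + x) ^ n\<close> is at
  most the whole sum. With \<open>x = v / n\<close> this is the familiar bound
  \<open>(e n / v) ^ v\<close>.\<close>

lemma choose_le_exp:
  fixes x :: real
  assumes "0 < x"
  shows "real (n choose v) \<le> exp (n * x) / x ^ v"
proof -
  have "real (n choose v) * x ^ v \<le> (1 + x) ^ n"
  proof (cases "v \<le> n")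
    case True
    have "real (n choose v) * x ^ v \<le> (\<Sum>j\<le>n. real (n choose j) * x ^ j)"
      using True assms by (intro member_le_sum) auto
    also have "\<dots> = (x + 1) ^ n"
      by (subst binomial_ring) simp
    finally show ?thesis by (simp add: add.commute)
  qed (use assms in \<open>simp add: not_le binomial_eq_0\<close>)
  also have "\<dots> \<le> exp x ^ n"
    using assms by (intro power_mono) auto
  also have "\<dots> = exp (n * x)"
    by (simp add: exp_of_nat_mult[symmetric])
  finally show ?thesis
    using assms by (simp add: field_simps)
qed

section \<open>Positivity of the threshold\<close>

text \<open>A variable occurring only once in a minimal unsatisfiable subformula could be set so as to
  satisfy its clause. Hence every variable of such a subformula occurs at least twice, which bounds
  the number of variables.\<close>

lemma unsatisfiable_core:
  assumes unsat: "\<not> satisfiable F" and F: "set F \<subseteq> k_clauses k n"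
  obtains s W where "s \<ge> 1" "s \<le> length F" "W \<subseteq> {..<n}" "2 * card W \<le> k * s"
    "s \<le> length (filter (\<lambda>C. C \<subseteq> W \<times> UNIV) F)"
proof -
  \<comment> \<open>Subformulas are sets of positions rather than of clauses, because a clause may
    be repeated in \<open>F\<close>. The core is an unsatisfiable set of positions that is minimal
    under inclusion.\<close>
  define sat where "sat S \<longleftrightarrow> (\<exists>\<tau>. \<forall>i\<in>S. \<exists>(v, b)\<in>F ! i. \<tau> v = b)" for S :: "nat set"
  let ?U = "{S. S \<subseteq> {..<length F} \<and> \<not> sat S}"
  have "{..<length F} \<in> ?U"
    using unsat by (auto simp: sat_def satisfiable_def set_conv_nth)
  moreover have "finite ?U"
    by simp
  ultimately obtain S where S: "S \<in> ?U" and min: "\<forall>T\<in>?U. T \<le> S \<longrightarrow> S = T"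
    using finite_has_minimal[of ?U] by blast
  define W where "W = (\<Union>i\<in>S. fst ` (F ! i))"
  have clause: "F ! i \<subseteq> {..<n} \<times> UNIV" "card (F ! i) = k" "inj_on fst (F ! i)" if "i \<in> S" for i
    using that S F nth_mem by (auto simp: k_clauses_def subset_iff)
  have finS: "finite S"
    using S finite_subset by blast
  have W: "W \<subseteq> {..<n}"
    unfolding W_def using clause(1) by fastforce
  have finW: "finite W"
    using W finite_subset by blast
  have twice: "2 \<le> card {i\<in>S. x \<in> fst ` (F ! i)}" if x: "x \<in> W" for x
  proof (rule ccontr)
    assume less: "\<not> 2 \<le> card {i\<in>S. x \<in> fst ` (F ! i)}"
    obtain i where i: "i \<in> S" "x \<in> fst ` (F ! i)"
      using x unfolding W_def by blast
    have "card {i\<in>S. x \<in> fst ` (F ! i)} \<le> 1"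
      using less by simp
    then have only: "j = i" if "j \<in> S" "x \<in> fst ` (F ! j)" for j
      using that i finS by (auto simp: card_le_Suc0_iff_eq)
    have "sat (S - {i})"
      using min[rule_format, of "S - {i}"] S i by auto
    then obtain \<tau> where \<tau>: "\<forall>j\<in>S - {i}. \<exists>(v, b)\<in>F ! j. \<tau> v = b"
      by (auto simp: sat_def)
    obtain b where b: "(x, b) \<in> F ! i"
      using i by auto
    \<comment> \<open>Redefining \<open>\<tau>\<close> at \<open>x\<close> satisfies clause
      \<open>i\<close> and keeps the other clauses of \<open>S\<close> satisfied, since none of them
      contains \<open>x\<close>.\<close>
    have "\<exists>(v, b')\<in>F ! j. (\<tau>(x := b)) v = b'" if j: "j \<in> S" for j
    proof (cases "j = i")
      case True
      then show ?thesis
        using b by (intro bexI[of _ "(x, b)"]) simp_all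
    next
      case False
      then have "j \<in> S - {i}"
        using j by simp
      with \<tau> obtain v b' where v: "(v, b') \<in> F ! j" "\<tau> v = b'"
        by blast
      have "v \<noteq> x"
      proof
        assume "v = x"
        then have "x \<in> fst ` (F ! j)"
          using v(1) image_eqI[of x fst "(x, b')"] by simp
        then show False
          using only[OF j] False by simp
      qed
      then show ?thesis
        using v by (intro bexI[of _ "(v, b')"]) simp_all
    qed
    then have "sat S"
      unfolding sat_def by blast
    then show False
      using S by simp
  qed
  \<comment> \<open>Double counting of the pairs of a variable and a core clause containing it: each
    variable contributes at least two pairs, each clause exactly \<open>k\<close>.\<close>
  have "2 * card W = (\<Sum>x\<in>W. 2)"
    by simp
  also have "\<dots> \<le> (\<Sum>x\<in>W. card {i\<in>S. x \<in> fst ` (F ! i)})"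
    using twice by (intro sum_mono)
  also have "\<dots> = (\<Sum>x\<in>W. \<Sum>i\<in>S. if x \<in> fst ` (F ! i) then 1 else 0)"
    using finS by (intro sum.cong) (auto simp: sum.If_cases Int_def)
  also have "\<dots> = (\<Sum>i\<in>S. \<Sum>x\<in>W. if x \<in> fst ` (F ! i) then 1 else 0)"
    by (rule sum.swap)
  also have "\<dots> = (\<Sum>i\<in>S. card (fst ` (F ! i)))"
  proof (rule sum.cong)
    fix i assume "i \<in> S"
    then have "W \<inter> fst ` (F ! i) = fst ` (F ! i)"
      by (auto simp: W_def)
    then show "(\<Sum>x\<in>W. if x \<in> fst ` (F ! i) then 1 else 0) = card (fst ` (F ! i))"
      using finW by (simp add: sum.If_cases Int_def)
  qed simp
  also have "\<dots> = k * card S"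
    using clause by (simp add: card_image)
  finally have card: "2 * card W \<le> k * card S" .
  have "S \<subseteq> {i. i < length F \<and> F ! i \<subseteq> W \<times> UNIV}"
    using S by (force simp: W_def)
  then have "card S \<le> length (filter (\<lambda>C. C \<subseteq> W \<times> UNIV) F)"
    unfolding length_filter_conv_card by (intro card_mono) auto
  \<comment> \<open>The empty set of clauses is satisfiable, so the core is not empty.\<close>
  moreover have "card S \<ge> 1"
    using S finS by (auto simp: sat_def Suc_le_eq card_gt_0_iff)
  moreover have "card S \<le> length F"
    using S card_mono[of "{..<length F}" S] by auto
  ultimately show ?thesis
    using that card W by blast
qed

text \<open>This bounds the expected number of variable sets of size \<open>k * s div 2\<close> that
  contain at least \<open>s\<close> clauses. With \<open>x = v / n\<close>, counting the sets costs
  at most \<open>exp (k s) / x ^ v\<close>, while the binomial tail supplies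
  \<open>x ^ ((k - 1) * s)\<close>. Since \<open>v \<le> (k - 1) * s\<close>, the powers of
  \<open>x\<close> combine to at most one, which leaves a bound that is geometric in
  \<open>s\<close>.\<close>

lemma unsatisfiable_core_bound:
  fixes \<alpha> :: real
  assumes "k \<ge> 2" "k \<le> n" "s \<ge> 1" "k * s div 2 \<le> n"
    and \<alpha>: "0 < \<alpha>" "\<alpha> * k \<le> 2" and m: "real m \<le> \<alpha> * n"
    and W: "W \<subseteq> {..<n}" "card W = k * s div 2"
  shows "(n choose (k * s div 2)) *
      measure_pmf.prob (random_formula k n m) {F. s \<le> length (filter (\<lambda>C. C \<subseteq> W \<times> UNIV) F)}
      \<le> (exp (real k + 1) * \<alpha> * k / 2) ^ s"
proof -
  define v where "v = k * s div 2"
  define x where "x = real v / real n"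
  define q where "q = real (v choose k) / real (n choose k)"
  \<comment> \<open>This value gives \<open>x ^ k * l * \<alpha> * n = 2 * v / k \<le> s\<close>, so
    the exponent in the tail bound is at most \<open>s\<close>. The condition
    \<open>\<alpha> * k \<le> 2\<close> ensures \<open>l \<ge> 1\<close>.\<close>
  define l where "l = 2 / (\<alpha> * k * x ^ (k - 1))"
  have n: "0 < n"
    using assms(1,2) by simp
  have "2 * s \<le> k * s"
    using assms(1) by simp
  then have sv: "s \<le> v" "2 * v \<le> k * s"
    unfolding v_def by linarith+
  have x: "0 < x" "x \<le> 1"
    using sv assms n by (auto simp: x_def v_def)
  have q: "0 \<le> q" "q \<le> x ^ k"
    using choose_ratio_le[of v n k] assms(4) by (auto simp: q_def x_def v_def)
  have q1: "q \<le> 1"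
    using q(2) x by (meson order.trans power_le_one less_imp_le)
  have "\<alpha> * k * x ^ (k - 1) \<le> 2 * 1"
    using \<alpha> x by (intro mult_mono) (auto intro: power_le_one)
  then have l: "1 \<le> l"
    using \<alpha> x assms(1) by (simp add: l_def)
  have "q * l * m \<le> x ^ k * l * (\<alpha> * n)"
    using q l m \<alpha> x by (intro mult_mono) auto
  also have "\<dots> = 2 * v / k"
  proof -
    have "x ^ k = x * x ^ (k - 1)"
      using assms(1) by (simp flip: power_Suc)
    then show ?thesis
      using x \<alpha> assms(1) n by (simp add: l_def) (simp add: x_def)
  qed
  also have "\<dots> \<le> s"
    using sv(2) assms(1) by (simp add: field_simps flip: of_nat_mult)
  finally have qlm: "q * l * m \<le> s" .
  have "measure_pmf.prob (random_formula k n m) {F. s \<le> length (filter (\<lambda>C. C \<subseteq> W \<times> UNIV) F)}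
      = measure_pmf.prob (map_pmf (\<lambda>F. length (filter (\<lambda>C. C \<subseteq> W \<times> UNIV) F))
          (random_formula k n m)) {s..}"
    by (simp add: vimage_def)
  also have "\<dots> = measure_pmf.prob (binomial_pmf m q) {s..}"
    using assms(2) W
    by (simp add: random_formula_def length_filter_replicate_pmf prob_random_clause_over q_def v_def)
  also have "\<dots> \<le> exp (q * l * m) / l ^ s"
    using q q1 l by (intro binomial_pmf_tail_le)
  also have "\<dots> \<le> exp s / l ^ s"
    using qlm l by (simp add: divide_right_mono)
  also have "\<dots> = (exp 1 * \<alpha> * k / 2) ^ s * x ^ ((k - 1) * s)"
    by (simp add: l_def power_divide power_mult_distrib power_mult exp_of_nat_mult[symmetric])
  finally have P: "measure_pmf.prob (random_formula k n m)
        {F. s \<le> length (filter (\<lambda>C. C \<subseteq> W \<times> UNIV) F)}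
      \<le> (exp 1 * \<alpha> * k / 2) ^ s * x ^ ((k - 1) * s)" .
  have "real (n choose v) \<le> exp (n * x) / x ^ v"
    using x by (intro choose_le_exp)
  also have "n * x = v"
    using n by (simp add: x_def)
  also have "exp (real v) / x ^ v \<le> exp (real k) ^ s / x ^ v"
    using sv x by (intro divide_right_mono)
      (auto simp: exp_of_nat_mult[symmetric] mult_ac simp flip: of_nat_mult)
  finally have N: "real (n choose v) \<le> exp (real k) ^ s / x ^ v" .
  \<comment> \<open>From \<open>s \<le> v\<close> and \<open>2 * v \<le> k * s\<close> one gets
    \<open>v \<le> k * s - v \<le> k * s - s\<close>.\<close>
  have vk: "v \<le> (k - 1) * s"
    using sv by (simp add: diff_mult_distrib)
  have "(n choose v) * measure_pmf.prob (random_formula k n m)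
        {F. s \<le> length (filter (\<lambda>C. C \<subseteq> W \<times> UNIV) F)}
      \<le> (exp (real k) ^ s / x ^ v) * ((exp 1 * \<alpha> * k / 2) ^ s * x ^ ((k - 1) * s))"
    using N P x by (intro mult_mono) auto
  also have "\<dots> = (exp (real k + 1) * \<alpha> * k / 2) ^ s * (x ^ ((k - 1) * s) / x ^ v)"
    by (simp add: exp_add power_mult_distrib power_divide mult_ac)
  also have "x ^ ((k - 1) * s) / x ^ v = x ^ ((k - 1) * s - v)"
    using x vk by (simp add: power_diff)
  also have "(exp (real k + 1) * \<alpha> * k / 2) ^ s * \<dots> \<le> (exp (real k + 1) * \<alpha> * k / 2) ^ s * 1"
    using x \<alpha> by (intro mult_left_mono power_le_one) auto
  finally show ?thesis
    by (simp add: v_def)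
qed

text \<open>A union bound over the core size \<open>s\<close> and the set \<open>W\<close> of core
  variables. The density is small enough that cores of size \<open>s\<close> contribute at most
  \<open>(1 / 4) ^ s\<close>, and these sum to less than \<open>1 / 3\<close>.\<close>

lemma prob_unsatisfiable_le:
  assumes k: "k \<ge> 2" and n: "k \<le> n"
  defines "\<alpha> \<equiv> 1 / (2 * k * exp (real k + 1))"
  shows "measure_pmf.prob (random_formula k n (nat \<lfloor>\<alpha> * n\<rfloor>)) {F. \<not> satisfiable F} \<le> 1 / 3"
proof -
  define m where "m = nat \<lfloor>\<alpha> * n\<rfloor>"
  define Ws where "Ws s = {W. W \<subseteq> {..<n} \<and> card W = k * s div 2}" for s
  define E where "E s W = {F :: cnf. s \<le> length (filter (\<lambda>C. C \<subseteq> W \<times> UNIV) F)}" for s W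
  let ?P = "measure_pmf.prob (random_formula k n m)"
  have \<alpha>: "0 < \<alpha>"
    using k by (simp add: \<alpha>_def)
  have "\<alpha> * k = 1 / (2 * exp (real k + 1))"
    using k by (simp add: \<alpha>_def)
  also have "\<dots> \<le> 1"
    using exp_ge_add_one_self[of "real k + 1"] by (simp add: divide_le_eq_1)
  finally have \<alpha>k: "\<alpha> * k \<le> 1" .
  have m: "real m \<le> \<alpha> * n"
    using \<alpha> by (simp add: m_def)
  \<comment> \<open>Cores have at most \<open>m\<close> clauses, so there is room among the
    \<open>n\<close> variables for a set of size \<open>k * s div 2\<close>.\<close>
  have core_le: "k * s div 2 \<le> n" if "s \<le> m" for s
  proof -
    have "real (k * s) \<le> k * (\<alpha> * n)"
      using m that by (simp add: mult_left_mono)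
    also have "\<dots> \<le> n"
      using \<alpha>k mult_right_mono[of "\<alpha> * k" 1 "real n"] by (simp add: mult_ac)
    finally show ?thesis by linarith
  qed
  have finWs: "finite (Ws s)" for s
    by (simp add: Ws_def)
  have "?P {F. \<not> satisfiable F} \<le> ?P (\<Union>s\<in>{1..m}. \<Union>W\<in>Ws s. E s W)"
  proof (rule measure_pmf.finite_measure_mono_AE)
    show "AE F in random_formula k n m. F \<in> {F. \<not> satisfiable F}
        \<longrightarrow> F \<in> (\<Union>s\<in>{1..m}. \<Union>W\<in>Ws s. E s W)"
    proof (rule AE_pmfI, rule impI)
      fix F assume "F \<in> set_pmf (random_formula k n m)" and "F \<in> {F. \<not> satisfiable F}"
      then have F: "set F \<subseteq> k_clauses k n" "length F = m" "\<not> satisfiable F"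
        using n by (auto simp: random_formula_def set_replicate_pmf set_random_clause)
      obtain s W where sW: "s \<ge> 1" "s \<le> m" "W \<subseteq> {..<n}" "2 * card W \<le> k * s"
          "s \<le> length (filter (\<lambda>C. C \<subseteq> W \<times> UNIV) F)"
        using unsatisfiable_core[OF F(3,1)] F(2) by auto
      have "card W \<le> k * s div 2" "k * s div 2 \<le> card {..<n}"
        using sW core_le by auto
      \<comment> \<open>Enlarging \<open>W\<close> to the maximal size allowed leaves a single
        cardinality for each \<open>s\<close> in the union bound, and only more clauses lie inside
        the larger set.\<close>
      then obtain W' where W': "W \<subseteq> W'" "W' \<subseteq> {..<n}" "card W' = k * s div 2"
        using exists_subset_between[of W "k * s div 2" "{..<n}"] sW(3) by auto
      have "length (filter (\<lambda>C. C \<subseteq> W \<times> UNIV) F) \<le> length (filter (\<lambda>C. C \<subseteq> W' \<times> UNIV) F)"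
        unfolding length_filter_conv_card using W'(1) by (intro card_mono) auto
      then have "F \<in> E s W'"
        using sW(5) by (simp add: E_def)
      then show "F \<in> (\<Union>s\<in>{1..m}. \<Union>W\<in>Ws s. E s W)"
        using sW(1,2) W' by (intro UN_I[of s] UN_I[of W']) (auto simp: Ws_def)
    qed
  qed simp
  also have "\<dots> \<le> (\<Sum>s\<in>{1..m}. ?P (\<Union>W\<in>Ws s. E s W))"
    by (rule measure_UNION_le) auto
  also have "\<dots> \<le> (\<Sum>s\<in>{1..m}. \<Sum>W\<in>Ws s. ?P (E s W))"
    using finWs by (intro sum_mono measure_UNION_le) auto
  also have "\<dots> \<le> (\<Sum>s\<in>{1..m}. (1 / 4) ^ s)"
  proof (rule sum_mono)
    fix s assume s: "s \<in> {1..m}"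
    have c: "card (Ws s) = (n choose (k * s div 2))"
      by (simp add: Ws_def n_subsets)
    \<comment> \<open>The density was chosen to make the base of the core bound equal to
      \<open>1 / 4\<close>.\<close>
    have quarter: "exp (real k + 1) * \<alpha> * k / 2 = 1 / 4"
      using k by (simp add: \<alpha>_def)
    have "card (Ws s) * ?P (E s W) \<le> (1 / 4) ^ s" if "W \<in> Ws s" for W
      unfolding c E_def
      using unsatisfiable_core_bound[of k n s \<alpha> m W] that s k n \<alpha> \<alpha>k m core_le[of s]
      by (simp only: quarter) (simp add: Ws_def)
    then have "?P (E s W) \<le> (1 / 4) ^ s / card (Ws s)" if "W \<in> Ws s" for W
      using that finWs by (subst pos_le_divide_eq) (auto simp: card_gt_0_iff mult.commute)
    then have "(\<Sum>W\<in>Ws s. ?P (E s W)) \<le> (\<Sum>W\<in>Ws s. (1 / 4) ^ s / card (Ws s))"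
      by (rule sum_mono)
    also have "\<dots> \<le> (1 / 4) ^ s"
      by simp
    finally show "(\<Sum>W\<in>Ws s. ?P (E s W)) \<le> (1 / 4) ^ s" .
  qed
  also have "\<dots> = (1 - (1 / 4) ^ m) / (3::real)"
    by (induction m) auto
  also have "\<dots> \<le> 1 / 3"
    by simp
  finally show ?thesis
    by (simp add: m_def)
qed

text \<open>A threshold that is not positive would make random formulas at the small positive
  density of the first moment bound unsatisfiable with probability tending to one, but that
  probability is at most \<open>1 / 3\<close>. Positivity leaves room for a nonnegative density
  below the threshold.\<close>

lemma sat_threshold_pos:
  assumes k: "k \<ge> 2" and thr: "is_sat_threshold k a"
  shows "0 < a"
proof (rule ccontr)
  assume "\<not> 0 < a"
  define \<alpha> where "\<alpha> = 1 / (2 * k * exp (real k + 1))"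
  let ?p = "\<lambda>n. measure_pmf.prob (random_formula k n (nat \<lfloor>\<alpha> * real n\<rfloor>)) {F. satisfiable F}"
  have "0 < \<alpha>"
    using k by (simp add: \<alpha>_def)
  then have "?p \<longlonglongrightarrow> 0"
    using thr \<open>\<not> 0 < a\<close> by (auto simp: is_sat_threshold_def)
  then have "\<forall>\<^sub>F n in sequentially. ?p n < 2 / 3"
    by (rule order_tendstoD) simp
  then obtain n where n: "n \<ge> k" "?p n < 2 / 3"
    using eventually_happens'[OF _ eventually_conj[OF _ eventually_ge_at_top[of k]]] by force
  have "measure_pmf.prob (random_formula k n (nat \<lfloor>\<alpha> * real n\<rfloor>)) {F. \<not> satisfiable F}
      = 1 - ?p n"
    by (subst measure_pmf.prob_compl[symmetric]) (auto intro: arg_cong2[where f = measure])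
  then show False
    using prob_unsatisfiable_le[OF k n(1)] n(2) by (simp add: \<alpha>_def)
qed

section \<open>The process that prefers an initial segment of the variables\<close>

definition prefer_inside :: "nat \<Rightarrow> nat \<Rightarrow> strategy" where
  "prefer_inside k n' h cs = (if cs ! 0 \<in> k_clauses k n' then cs ! 0 else cs ! 1)"

lemma is_strategy_prefer: "is_strategy 2 (prefer_inside k n')"
  by (auto simp: is_strategy_def prefer_inside_def)

text \<open>The choice ignores the history, so the selected clauses are independent and identically
  distributed.\<close>

lemma achlioptas_formula_prefer:
  "achlioptas_formula 2 k n (prefer_inside k n') m =
     replicate_pmf m (bind_pmf (random_clause k n) (\<lambda>c.
       bind_pmf (random_clause k n) (\<lambda>d. return_pmf (if c \<in> k_clauses k n' then c else d))))"
proof (induction m)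
  case (Suc m)
  let ?D = "bind_pmf (random_clause k n) (\<lambda>c.
       bind_pmf (random_clause k n) (\<lambda>d. return_pmf (if c \<in> k_clauses k n' then c else d)))"
  have pick: "map_pmf (prefer_inside k n' h) (replicate_pmf 2 (random_clause k n)) = ?D" for h
  proof -
    have "prefer_inside k n' h [c, d] = (if c \<in> k_clauses k n' then c else d)" for c d
      by (simp add: prefer_inside_def)
    then show ?thesis
      unfolding numeral_2_eq_2 replicate_pmf.simps map_bind_pmf bind_assoc_pmf bind_return_pmf
        map_return_pmf by simp
  qed
  have "achlioptas_formula 2 k n (prefer_inside k n') (Suc m) =
      bind_pmf (achlioptas_process 2 k n (prefer_inside k n') m) (\<lambda>h.
        map_pmf (\<lambda>c. map snd h @ [c])
          (map_pmf (prefer_inside k n' h) (replicate_pmf 2 (random_clause k n))))"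
    by (simp add: achlioptas_formula_def map_bind_pmf map_pmf_comp)
  also have "\<dots> = bind_pmf (achlioptas_formula 2 k n (prefer_inside k n') m)
      (\<lambda>F. map_pmf (\<lambda>c. F @ [c]) ?D)"
    unfolding pick by (simp add: achlioptas_formula_def bind_map_pmf)
  \<comment> \<open>The process appends the new clause at the end whereas
    \<open>replicate_pmf\<close> adds it in front; splitting \<open>m + 1\<close> samples into
    \<open>m\<close> and one reconciles the two.\<close>
  also have "\<dots> = replicate_pmf (m + 1) ?D"
    unfolding Suc.IH replicate_pmf_distrib replicate_pmf_1
    by (simp add: bind_map_pmf map_pmf_def bind_assoc_pmf bind_return_pmf)
  finally show ?case by simp
qed (simp add: achlioptas_formula_def)

section \<open>Clauses inside and outside the preferred variables\<close>

text \<open>A uniform sample from \<open>S\<close> can be drawn in two stages: decide whether it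
  lies in \<open>T\<close>, then draw uniformly from the part decided on.\<close>

lemma pmf_of_set_eq_bernoulli_mixture:
  assumes "finite S" "T \<subseteq> S" "T \<noteq> {}" "S - T \<noteq> {}"
  shows "pmf_of_set S = bind_pmf (bernoulli_pmf (card T / card S))
    (\<lambda>b. if b then pmf_of_set T else pmf_of_set (S - T))"
proof (rule pmf_eqI)
  fix x
  have T: "finite T" "card T \<le> card S" "card T > 0"
    using assms by (auto intro: finite_subset card_mono simp: card_gt_0_iff)
  have "card (S - T) > 0"
    using assms by (subst card_gt_0_iff) auto
  then have *: "card T < card S" "real (card (S - T)) = card S - card T"
    using assms T by (auto simp: card_Diff_subset of_nat_diff)
  have p: "0 \<le> real (card T) / card S" "real (card T) / card S \<le> 1"
    using T by auto
  have "pmf (bind_pmf (bernoulli_pmf (card T / card S))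
      (\<lambda>b. if b then pmf_of_set T else pmf_of_set (S - T))) x
    = card T / card S * (indicator T x / card T)
      + (1 - card T / card S) * (indicator (S - T) x / card (S - T))"
    using assms T p by (simp add: pmf_bind)
  also have "1 - card T / card S = card (S - T) / card S"
    using * by (simp add: diff_divide_distrib)
  also have "card T / card S * (indicator T x / card T)
      + card (S - T) / card S * (indicator (S - T) x / card (S - T))
      = (indicator T x + indicator (S - T) x) / card S"
    using T(3) \<open>card (S - T) > 0\<close> by (simp add: add_divide_distrib)
  also have "indicator T x + indicator (S - T) x = (indicator S x :: real)"
    using assms(2) by (auto simp: indicator_def)
  also have "\<dots> / card S = pmf (pmf_of_set S) x"
    using assms by (subst pmf_of_set) auto
  finally show "pmf (pmf_of_set S) x = pmf (bind_pmf (bernoulli_pmf (card T / card S))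
    (\<lambda>b. if b then pmf_of_set T else pmf_of_set (S - T))) x" ..
qed

text \<open>The selected sample misses \<open>A\<close> only if both samples do, which has
  probability \<open>(1 - q)\<^sup>2\<close>. The laws \<open>R\<close> and \<open>E\<close>
  conditional on being inside or outside \<open>A\<close> are unchanged; only the weight of
  \<open>R\<close> grows.\<close>

lemma first_preferred_mixture:
  fixes q :: real and R E :: "'a pmf"
  assumes q: "0 \<le> q" "q \<le> 1" and R: "set_pmf R \<subseteq> A" and E: "set_pmf E \<inter> A = {}"
  defines "M \<equiv> bind_pmf (bernoulli_pmf q) (\<lambda>b. if b then R else E)"
  shows "bind_pmf M (\<lambda>c. bind_pmf M (\<lambda>d. return_pmf (if c \<in> A then c else d)))
    = bind_pmf (bernoulli_pmf (1 - (1 - q)\<^sup>2)) (\<lambda>b. if b then R else E)"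
proof -
  have or: "bernoulli_pmf (1 - (1 - q)\<^sup>2) =
      bind_pmf (bernoulli_pmf q) (\<lambda>b. bind_pmf (bernoulli_pmf q) (\<lambda>b'. return_pmf (b \<or> b')))"
  proof (rule pmf_eqI)
    fix i
    have "0 \<le> 1 - (1 - q)\<^sup>2" "1 - (1 - q)\<^sup>2 \<le> 1"
      using q by (auto simp: power_le_one)
    then show "pmf (bernoulli_pmf (1 - (1 - q)\<^sup>2)) i = pmf (bind_pmf (bernoulli_pmf q)
        (\<lambda>b. bind_pmf (bernoulli_pmf q) (\<lambda>b'. return_pmf (b \<or> b')))) i"
      using q by (cases i) (simp_all add: pmf_bind power2_eq_square algebra_simps)
  qed
  \<comment> \<open>A first sample from \<open>R\<close> is kept, so the second is irrelevant; a
    first sample from \<open>E\<close> is replaced by a fresh sample of \<open>M\<close>.\<close>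
  have 1: "bind_pmf R (\<lambda>c. bind_pmf M (\<lambda>d. return_pmf (if c \<in> A then c else d))) = R"
  proof -
    have "bind_pmf R (\<lambda>c. bind_pmf M (\<lambda>d. return_pmf (if c \<in> A then c else d)))
        = bind_pmf R (\<lambda>c. return_pmf c)"
      using R by (intro bind_pmf_cong) auto
    then show ?thesis by (simp add: bind_return_pmf')
  qed
  have 2: "bind_pmf E (\<lambda>c. bind_pmf M (\<lambda>d. return_pmf (if c \<in> A then c else d))) = M"
  proof -
    have "bind_pmf E (\<lambda>c. bind_pmf M (\<lambda>d. return_pmf (if c \<in> A then c else d)))
        = bind_pmf E (\<lambda>c. M)"
    proof (rule bind_pmf_cong[OF refl])
      fix c assume "c \<in> set_pmf E"
      then have "c \<notin> A" using E by blast
      then show "bind_pmf M (\<lambda>d. return_pmf (if c \<in> A then c else d)) = M"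
        by (simp add: bind_return_pmf')
    qed
    then show ?thesis by simp
  qed
  have "bind_pmf M (\<lambda>c. bind_pmf M (\<lambda>d. return_pmf (if c \<in> A then c else d)))
      = bind_pmf (bernoulli_pmf q) (\<lambda>b. if b then R else M)"
    by (subst (1) M_def) (auto simp: bind_assoc_pmf 1 2 intro!: bind_pmf_cong)
  also have "\<dots> = bind_pmf (bernoulli_pmf (1 - (1 - q)\<^sup>2)) (\<lambda>b. if b then R else E)"
    unfolding or by (auto simp: bind_assoc_pmf bind_return_pmf M_def intro!: bind_pmf_cong)
  finally show ?thesis .
qed

text \<open>Filtering keeps exactly the samples drawn from \<open>R\<close>. Their number is
  binomial, and given that number they are still independent with law \<open>R\<close>.\<close>

lemma filter_replicate_mixture:
  fixes p :: real and R E :: "'a pmf"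
  assumes p: "0 \<le> p" "p \<le> 1" and R: "set_pmf R \<subseteq> A" and E: "set_pmf E \<inter> A = {}"
  shows "map_pmf (filter (\<lambda>x. x \<in> A))
      (replicate_pmf m (bind_pmf (bernoulli_pmf p) (\<lambda>b. if b then R else E)))
    = bind_pmf (binomial_pmf m p) (\<lambda>j. replicate_pmf j R)"
proof (induction m)
  case 0
  then show ?case
    using p by (simp add: binomial_pmf_0 bind_return_pmf)
next
  case (Suc m)
  let ?D = "bind_pmf (bernoulli_pmf p) (\<lambda>b. if b then R else E)"
  let ?Z = "\<lambda>m. map_pmf (filter (\<lambda>x. x \<in> A)) (replicate_pmf m ?D)"
  have 1: "bind_pmf R (\<lambda>x. bind_pmf (replicate_pmf m ?D) (\<lambda>xs. return_pmf (filter (\<lambda>x. x \<in> A) (x # xs))))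
      = bind_pmf R (\<lambda>x. bind_pmf (?Z m) (\<lambda>ys. return_pmf (x # ys)))"
  proof (rule bind_pmf_cong[OF refl])
    fix x assume "x \<in> set_pmf R"
    then have "x \<in> A" using R by blast
    then show "bind_pmf (replicate_pmf m ?D) (\<lambda>xs. return_pmf (filter (\<lambda>x. x \<in> A) (x # xs)))
        = bind_pmf (?Z m) (\<lambda>ys. return_pmf (x # ys))"
      by (simp add: bind_map_pmf)
  qed
  have 2: "bind_pmf E (\<lambda>x. bind_pmf (replicate_pmf m ?D) (\<lambda>xs. return_pmf (filter (\<lambda>x. x \<in> A) (x # xs))))
      = ?Z m"
  proof -
    have "bind_pmf E (\<lambda>x. bind_pmf (replicate_pmf m ?D) (\<lambda>xs. return_pmf (filter (\<lambda>x. x \<in> A) (x # xs))))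
        = bind_pmf E (\<lambda>x. ?Z m)"
    proof (rule bind_pmf_cong[OF refl])
      fix x assume "x \<in> set_pmf E"
      then have "x \<notin> A" using E by blast
      then show "bind_pmf (replicate_pmf m ?D) (\<lambda>xs. return_pmf (filter (\<lambda>x. x \<in> A) (x # xs)))
          = ?Z m"
        by (simp add: map_pmf_def)
    qed
    then show ?thesis by simp
  qed
  have "?Z (Suc m) = bind_pmf (bernoulli_pmf p) (\<lambda>b.
      if b then bind_pmf R (\<lambda>x. bind_pmf (?Z m) (\<lambda>ys. return_pmf (x # ys))) else ?Z m)"
    unfolding replicate_pmf.simps map_bind_pmf bind_assoc_pmf map_return_pmf
  proof (rule bind_pmf_cong[OF refl])
    fix b
    show "bind_pmf (if b then R else E) (\<lambda>x. bind_pmf (replicate_pmf m ?D)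
          (\<lambda>xs. return_pmf (filter (\<lambda>x. x \<in> A) (x # xs))))
        = (if b then bind_pmf R (\<lambda>x. bind_pmf (?Z m) (\<lambda>ys. return_pmf (x # ys))) else ?Z m)"
      by (cases b) (simp_all only: 1 2 if_True if_False)
  qed
  \<comment> \<open>The new element is independent of the count \<open>j\<close>, so the two draws
    can be exchanged and the element absorbed into the list of length \<open>j\<close>.\<close>
  also have "\<dots> = bind_pmf (bernoulli_pmf p) (\<lambda>b. bind_pmf (binomial_pmf m p)
      (\<lambda>j. replicate_pmf ((if b then 1 else 0) + j) R))"
    unfolding Suc.IH
  proof (rule bind_pmf_cong[OF refl])
    fix b
    show "(if b then bind_pmf R (\<lambda>x. bind_pmf (bind_pmf (binomial_pmf m p) (\<lambda>j. replicate_pmf j R))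
          (\<lambda>ys. return_pmf (x # ys))) else bind_pmf (binomial_pmf m p) (\<lambda>j. replicate_pmf j R))
        = bind_pmf (binomial_pmf m p) (\<lambda>j. replicate_pmf ((if b then 1 else 0) + j) R)"
      by (cases b) (simp_all add: bind_assoc_pmf bind_commute_pmf[of R])
  qed
  also have "\<dots> = bind_pmf (binomial_pmf (Suc m) p) (\<lambda>j. replicate_pmf j R)"
    using p by (simp add: binomial_pmf_Suc bind_assoc_pmf bind_return_pmf)
  finally show ?case .
qed

section \<open>Monotonicity and transfer to the process\<close>

lemma satisfiable_mono: "satisfiable F \<Longrightarrow> set G \<subseteq> set F \<Longrightarrow> satisfiable G"
  unfolding satisfiable_def by blast

text \<open>The two formulas are coupled: the first \<open>i\<close> clauses of the longer one are
  distributed as the shorter one.\<close>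

lemma prob_unsatisfiable_mono:
  assumes "i \<le> j"
  shows "measure_pmf.prob (replicate_pmf i R) {F. \<not> satisfiable F}
    \<le> measure_pmf.prob (replicate_pmf j R) {F. \<not> satisfiable F}"
proof -
  obtain d where j: "j = i + d"
    using assms le_Suc_ex by blast
  have "bind_pmf (replicate_pmf j R) (\<lambda>F. return_pmf (take i F)) = replicate_pmf i R"
  proof -
    have "bind_pmf (replicate_pmf j R) (\<lambda>F. return_pmf (take i F))
        = bind_pmf (replicate_pmf i R) (\<lambda>xs. bind_pmf (replicate_pmf d R) (\<lambda>ys. return_pmf xs))"
      unfolding j replicate_pmf_distrib bind_assoc_pmf bind_return_pmf
      by (intro bind_pmf_cong) (auto simp: set_replicate_pmf)
    then show ?thesis by (simp add: bind_return_pmf')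
  qed
  then have "replicate_pmf i R = map_pmf (take i) (replicate_pmf j R)"
    by (simp add: map_pmf_def)
  then have "measure_pmf.prob (replicate_pmf i R) {F. \<not> satisfiable F}
      = measure_pmf.prob (replicate_pmf j R) (take i -` {F. \<not> satisfiable F})"
    by simp
  also have "\<dots> \<le> measure_pmf.prob (replicate_pmf j R) {F. \<not> satisfiable F}"
    by (intro measure_pmf.finite_measure_mono)
      (auto dest: satisfiable_mono[OF _ set_take_subset])
  finally show ?thesis .
qed

lemma measure_bind_pmf:
  "measure_pmf.prob (bind_pmf M N) X = measure_pmf.expectation M (\<lambda>x. measure_pmf.prob (N x) X)"
proof -
  have "ennreal (measure_pmf.prob (bind_pmf M N) X)
      = (\<integral>\<^sup>+x. ennreal (measure_pmf.prob (N x) X) \<partial>M)"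
    by (simp flip: measure_pmf.emeasure_eq_measure)
  also have "\<dots> = ennreal (measure_pmf.expectation M (\<lambda>x. measure_pmf.prob (N x) X))"
    by (intro nn_integral_eq_integral measure_pmf.integrable_const_bound[where B = 1]) auto
  finally show ?thesis
    by (simp add: integral_nonneg_AE)
qed

text \<open>Averaging over the number \<open>j\<close> of clauses, the contribution of
  \<open>j < s\<close> is bounded below by zero and that of \<open>j \<ge> s\<close> by
  monotonicity.\<close>

lemma prob_unsatisfiable_binomial_ge:
  assumes p: "0 \<le> p" "p \<le> 1"
  shows "measure_pmf.prob (bind_pmf (binomial_pmf m p) (\<lambda>j. replicate_pmf j R)) {F. \<not> satisfiable F}
    \<ge> measure_pmf.prob (binomial_pmf m p) {s..}
      * measure_pmf.prob (replicate_pmf s R) {F. \<not> satisfiable F}"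
proof -
  let ?u = "\<lambda>j. measure_pmf.prob (replicate_pmf j R) {F. \<not> satisfiable F}"
  have "measure_pmf.prob (binomial_pmf m p) {s..} * ?u s
      = measure_pmf.expectation (binomial_pmf m p) (\<lambda>j. indicator {s..} j * ?u s)"
    by simp
  also have "\<dots> \<le> measure_pmf.expectation (binomial_pmf m p) ?u"
    using p by (intro integral_mono) (auto simp: indicator_def prob_unsatisfiable_mono)
  finally show ?thesis
    by (simp add: measure_bind_pmf)
qed

text \<open>The clauses selected inside the preferred variables form a random formula on
  \<open>n'\<close> variables with a binomial number of clauses. The whole formula is unsatisfiable
  as soon as this subformula is.\<close>

lemma prob_achlioptas_unsatisfiable_ge:
  assumes k: "1 \<le> k" "k \<le> n'" "n' < n"
  defines "q \<equiv> real (n' choose k) / real (n choose k)"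
  shows "measure_pmf.prob (achlioptas_formula 2 k n (prefer_inside k n') m) {F. \<not> satisfiable F}
    \<ge> measure_pmf.prob (binomial_pmf m (1 - (1 - q)\<^sup>2)) {s..}
      * measure_pmf.prob (random_formula k n' s) {F. \<not> satisfiable F}"
proof -
  let ?A = "k_clauses k n'" and ?S = "k_clauses k n"
  let ?R = "random_clause k n'" and ?E = "pmf_of_set (?S - ?A)"
  have sub: "?A \<subseteq> ?S"
    using k by (force simp: k_clauses_def)
  \<comment> \<open>Strictness guarantees that some clause lies outside the preferred variables, so
    that \<open>?E\<close> is a uniform distribution on a nonempty set.\<close>
  have "(real n' / real n) ^ k < 1 ^ k"
    using k by (intro power_strict_mono) auto
  moreover have "real (n' choose k) / real (n choose k) \<le> (real n' / real n) ^ k"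
    using k by (intro choose_ratio_le) simp
  ultimately have "real (n' choose k) / real (n choose k) < 1"
    by simp
  then have "n' choose k < n choose k"
    using k by (simp add: divide_less_eq)
  then have card: "card ?A < card ?S"
    by (simp add: k_clauses_eq card_clauses_over)
  then have ne: "?S - ?A \<noteq> {}"
    using sub by auto
  have q_eq: "q = card ?A / card ?S"
    by (simp add: q_def k_clauses_eq card_clauses_over)
  have q: "0 \<le> q" "q \<le> 1"
    using card by (auto simp: q_eq divide_le_eq_1)
  have R: "set_pmf ?R \<subseteq> ?A"
    using k by (simp add: set_random_clause)
  have E: "set_pmf ?E \<inter> ?A = {}"
    using ne by (simp add: finite_k_clauses) blast
  have p: "0 \<le> 1 - (1 - q)\<^sup>2" "1 - (1 - q)\<^sup>2 \<le> 1"
    using q by (auto simp: power_le_one)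
  have M: "random_clause k n = bind_pmf (bernoulli_pmf q) (\<lambda>b. if b then ?R else ?E)"
    unfolding random_clause_def q_eq
    using k sub ne by (intro pmf_of_set_eq_bernoulli_mixture)
      (auto simp: finite_k_clauses k_clauses_nonempty)
  have "map_pmf (filter (\<lambda>C. C \<in> ?A)) (achlioptas_formula 2 k n (prefer_inside k n') m)
      = bind_pmf (binomial_pmf m (1 - (1 - q)\<^sup>2)) (\<lambda>j. replicate_pmf j ?R)"
    unfolding achlioptas_formula_prefer M first_preferred_mixture[OF q R E]
    by (rule filter_replicate_mixture[OF p R E])
  then have "measure_pmf.prob (binomial_pmf m (1 - (1 - q)\<^sup>2)) {s..}
      * measure_pmf.prob (random_formula k n' s) {F. \<not> satisfiable F}
    \<le> measure_pmf.prob (map_pmf (filter (\<lambda>C. C \<in> ?A))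
        (achlioptas_formula 2 k n (prefer_inside k n') m)) {F. \<not> satisfiable F}"
    using prob_unsatisfiable_binomial_ge[OF p] by (simp add: random_formula_def)
  also have "\<dots> = measure_pmf.prob (achlioptas_formula 2 k n (prefer_inside k n') m)
      (filter (\<lambda>C. C \<in> ?A) -` {F. \<not> satisfiable F})"
    by simp
  also have "\<dots> \<le> measure_pmf.prob (achlioptas_formula 2 k n (prefer_inside k n') m) {F. \<not> satisfiable F}"
    by (intro measure_pmf.finite_measure_mono) (auto dest: satisfiable_mono[OF _ filter_is_subset])
  finally show ?thesis .
qed

section \<open>Asymptotics\<close>

lemma tendsto_floor_mult_div:
  fixes b :: real
  assumes "0 \<le> b"
  shows "(\<lambda>n. real (nat \<lfloor>b * real n\<rfloor>) / real n) \<longlonglongrightarrow> b"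
proof (rule tendsto_sandwich)
  show "\<forall>\<^sub>F n in sequentially. b - 1 / real n \<le> real (nat \<lfloor>b * real n\<rfloor>) / real n"
    using eventually_gt_at_top[of 0]
  proof eventually_elim
    case (elim n)
    have "b * real n - 1 \<le> real (nat \<lfloor>b * real n\<rfloor>)"
      by linarith
    then have "(b * real n - 1) / real n \<le> real (nat \<lfloor>b * real n\<rfloor>) / real n"
      by (rule divide_right_mono) simp
    then show ?case
      using elim by (simp add: diff_divide_distrib)
  qed
  show "\<forall>\<^sub>F n in sequentially. real (nat \<lfloor>b * real n\<rfloor>) / real n \<le> b"
    using eventually_gt_at_top[of 0]
  proof eventually_elim
    case (elim n)
    have "real (nat \<lfloor>b * real n\<rfloor>) \<le> b * real n"
      using assms by simp
    then show ?case
      using elim by (simp add: divide_le_eq)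
  qed
  show "(\<lambda>n. b - 1 / real n) \<longlonglongrightarrow> b"
    by real_asymp
qed simp

lemma filterlim_floor_mult:
  fixes b :: real
  assumes "0 < b"
  shows "filterlim (\<lambda>n. nat \<lfloor>b * real n\<rfloor>) at_top sequentially"
  using assms by real_asymp

text \<open>Dividing numerator and denominator of each of the \<open>k\<close> factors by
  \<open>n\<close> shows that every factor tends to \<open>b\<close>.\<close>

lemma tendsto_choose_ratio:
  fixes b :: real
  assumes b: "0 < b" "b \<le> 1"
  shows "(\<lambda>n. real (nat \<lfloor>b * real n\<rfloor> choose k) / real (n choose k)) \<longlonglongrightarrow> b ^ k"
proof -
  let ?v = "\<lambda>n. nat \<lfloor>b * real n\<rfloor>"
  have "(\<lambda>n. \<Prod>i<k. (real (?v n) / real n - real i / real n) / (1 - real i / real n)) \<longlonglongrightarrow> (\<Prod>i<k. (b - 0) / (1 - 0))"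
    using b by (intro tendsto_prod tendsto_divide tendsto_diff tendsto_floor_mult_div tendsto_const)
      (auto intro: lim_const_over_n)
  moreover have "\<forall>\<^sub>F n in sequentially. (\<Prod>i<k. (real (?v n) / real n - real i / real n) / (1 - real i / real n))
      = real (?v n choose k) / real (n choose k)"
    \<comment> \<open>Once \<open>?v n \<ge> k\<close>, the truncated subtractions in the product
      agree with real ones.\<close>
    using eventually_compose_filterlim[OF eventually_ge_at_top[of k] filterlim_floor_mult[OF b(1)]] eventually_gt_at_top[of 0]
  proof eventually_elim
    case (elim n)
    have "b * real n \<le> real n"
      using b by (simp add: mult_left_le_one_le)
    then have "?v n \<le> n"
      by linarith
    then have "real (?v n choose k) / real (n choose k) = (\<Prod>i<k. real (?v n - i) / real (n - i))"
      using elim by (intro choose_ratio_eq_prod)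
    also have "\<dots> = (\<Prod>i<k. (real (?v n) / real n - real i / real n) / (1 - real i / real n))"
    proof (rule prod.cong)
      fix i assume i: "i \<in> {..<k}"
      have "real (?v n) / real n - real i / real n = real (?v n - i) / real n"
        "1 - real i / real n = real (n - i) / real n"
        using i elim \<open>?v n \<le> n\<close> by (auto simp: of_nat_diff diff_divide_distrib)
      then show "real (?v n - i) / real (n - i) = (real (?v n) / real n - real i / real n) / (1 - real i / real n)"
        using elim by simp
    qed simp
    finally show ?case ..
  qed
  ultimately have "(\<lambda>n. real (?v n choose k) / real (n choose k)) \<longlonglongrightarrow> (\<Prod>i<k. (b - 0) / (1 - 0))"
    by (rule Lim_transform_eventually)
  then show ?thesis by simp
qed

text \<open>The success rate \<open>p n\<close> eventually exceeds the required fraction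
  \<open>s n / m n\<close> by a fixed margin, so Hoeffding's inequality makes falling short
  exponentially unlikely in \<open>m n\<close>.\<close>

lemma binomial_concentration:
  fixes p :: "nat \<Rightarrow> real" and m s :: "nat \<Rightarrow> nat"
  assumes p01: "\<And>n. 0 \<le> p n \<and> p n \<le> 1"
    and m: "filterlim m at_top sequentially" and p: "p \<longlonglongrightarrow> P"
    and s: "(\<lambda>n. real (s n) / real (m n)) \<longlonglongrightarrow> S" and SP: "S < P"
  shows "(\<lambda>n. measure_pmf.prob (binomial_pmf (m n) (p n)) {s n..}) \<longlonglongrightarrow> 1"
proof (rule tendsto_sandwich)
  \<comment> \<open>Half of the limiting gap, so that the actual gap eventually exceeds it.\<close>
  define e where "e = (P - S) / 2"
  have e: "0 < e"
    using SP by (simp add: e_def)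
  have "(\<lambda>n. p n - real (s n) / real (m n)) \<longlonglongrightarrow> P - S"
    by (intro tendsto_diff p s)
  then have ev: "\<forall>\<^sub>F n in sequentially. e < p n - real (s n) / real (m n)"
    by (rule order_tendstoD) (use SP in \<open>simp add: e_def\<close>)
  have mpos: "\<forall>\<^sub>F n in sequentially. 0 < m n"
    using eventually_compose_filterlim[OF eventually_gt_at_top m] .
  show "\<forall>\<^sub>F n in sequentially. 1 - exp (- 2 * real (m n) * e\<^sup>2)
      \<le> measure_pmf.prob (binomial_pmf (m n) (p n)) {s n..}"
    using ev mpos
  proof eventually_elim
    case (elim n)
    interpret binomial_distribution "m n" "p n"
      by unfold_locales (use p01 in auto)
    have "1 - measure_pmf.prob (binomial_pmf (m n) (p n)) {s n..}
        = measure_pmf.prob (binomial_pmf (m n) (p n)) (UNIV - {s n..})"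
      by (subst measure_pmf.prob_compl[symmetric]) auto
    also have "\<dots> \<le> measure_pmf.prob (binomial_pmf (m n) (p n)) {x. real x / real (m n) \<le> p n - e}"
    proof (rule measure_pmf.finite_measure_mono)
      show "UNIV - {s n..} \<subseteq> {x. real x / real (m n) \<le> p n - e}"
      proof
        fix x assume "x \<in> UNIV - {s n..}"
        then have "real x / real (m n) \<le> real (s n) / real (m n)"
          by (intro divide_right_mono) auto
        then show "x \<in> {x. real x / real (m n) \<le> p n - e}"
          using elim by simp
      qed
    qed simp
    also have "\<dots> \<le> exp (- 2 * real (m n) * e\<^sup>2)"
      using prob_le'[of e] elim e by simp
    finally show ?case by simp
  qed
  have "filterlim (\<lambda>n. real (m n)) at_top sequentially"
    using m by (rule filterlim_compose[OF filterlim_real_sequentially])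
  then have "filterlim (\<lambda>n. (- 2 * e\<^sup>2) * real (m n)) at_bot sequentially"
    using e by (intro filterlim_tendsto_neg_mult_at_bot[OF tendsto_const]) auto
  then have "(\<lambda>n. exp ((- 2 * e\<^sup>2) * real (m n))) \<longlonglongrightarrow> 0"
    by (rule filterlim_compose[OF exp_at_bot])
  then have "(\<lambda>n. 1 - exp (- 2 * real (m n) * e\<^sup>2)) \<longlonglongrightarrow> 1 - 0"
    by (intro tendsto_diff tendsto_const) (simp add: mult_ac)
  then show "(\<lambda>n. 1 - exp (- 2 * real (m n) * e\<^sup>2)) \<longlonglongrightarrow> 1"
    by simp
qed auto

section \<open>Choice of the parameters and conclusion\<close>

text \<open>With \<open>b = 1 - e\<close> and \<open>y = b ^ (k - 1)\<close> the factor equals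
  \<open>1 - (1 - y)\<^sup>2 + e * y\<^sup>2\<close>. The loss is of second order in
  \<open>e\<close> and the gain of first order.\<close>

lemma exists_density_gain:
  assumes "k \<ge> 2"
  obtains b :: real where "0 < b" "b < 1" "1 < 2 * b ^ (k - 1) - b ^ (2 * k - 1)"
proof -
  \<comment> \<open>Bernoulli's inequality gives \<open>1 - y \<le> k * e\<close>, and this
    \<open>e\<close> satisfies \<open>(k * e)\<^sup>2 = e / 4\<close>, below the gain of at least
    \<open>(7 / 8)\<^sup>2 * e\<close>.\<close>
  define e where "e = 1 / (4 * (real k)\<^sup>2)"
  define y where "y = (1 - e) ^ (k - 1)"
  have k: "2 \<le> real k"
    using assms by simp
  have k2: "4 \<le> (real k)\<^sup>2"
    using power_mono[OF k, of 2] by simp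
  have e: "0 < e" "e \<le> 1 / 16"
    using k k2 by (auto simp: e_def field_simps)
  have "1 + real (k - 1) * (- e) \<le> (1 + (- e)) ^ (k - 1)"
    using e by (intro Bernoulli_inequality) auto
  then have "1 - real (k - 1) * e \<le> y"
    by (simp add: y_def)
  moreover have "real (k - 1) * e \<le> real k * e"
    using e by (intro mult_right_mono) auto
  ultimately have y: "1 - real k * e \<le> y"
    by linarith
  have y1: "y \<le> 1"
    using e by (simp add: y_def power_le_one)
  have ke: "real k * e \<le> 1 / 8"
    using k by (simp add: e_def power2_eq_square field_simps)
  have "(1 - y)\<^sup>2 \<le> (real k * e)\<^sup>2"
    using y y1 by (intro power_mono) auto
  also have "\<dots> = e / 4"
    using k by (simp add: e_def power_mult_distrib power2_eq_square)
  finally have 1: "(1 - y)\<^sup>2 \<le> e / 4" .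
  have "(7 / 8)\<^sup>2 \<le> y\<^sup>2"
    using y ke by (intro power_mono) auto
  then have "e * (7 / 8)\<^sup>2 \<le> e * y\<^sup>2"
    using e by (intro mult_left_mono) auto
  then have 2: "e / 4 < e * y\<^sup>2"
    using e by (simp add: power2_eq_square)
  have "2 * k - 1 = Suc ((k - 1) * 2)"
    using assms by simp
  then have "(1 - e) ^ (2 * k - 1) = (1 - e) * y\<^sup>2"
    by (simp only: y_def power_Suc power_mult)
  then have "2 * (1 - e) ^ (k - 1) - (1 - e) ^ (2 * k - 1) = 2 * y - (1 - e) * y\<^sup>2"
    by (simp only: y_def)
  also have "\<dots> = 1 - (1 - y)\<^sup>2 + e * y\<^sup>2"
    by (simp add: power2_eq_square algebra_simps)
  finally have "2 * (1 - e) ^ (k - 1) - (1 - e) ^ (2 * k - 1) = 1 - (1 - y)\<^sup>2 + e * y\<^sup>2" .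
  then show ?thesis
    using that[of "1 - e"] e 1 2 by simp
qed

theorem theorem5:
  fixes k :: nat and \<alpha>\<^sub>k :: real
  assumes "k \<ge> 2"
    and "is_sat_threshold k \<alpha>\<^sub>k"
  shows "\<exists>\<alpha>::real. 0 \<le> \<alpha> \<and> \<alpha> < \<alpha>\<^sub>k \<and>
           (\<exists>\<sigma> :: nat \<Rightarrow> strategy. (\<forall>n. is_strategy 2 (\<sigma> n)) \<and>
              (\<lambda>n. measure_pmf.prob
                     (achlioptas_formula 2 k n (\<sigma> n) (nat \<lfloor>\<alpha> * real n\<rfloor>))
                     {F. \<not> satisfiable F}) \<longlonglongrightarrow> 1)"
proof -
  have pos: "0 < \<alpha>\<^sub>k"
    using sat_threshold_pos assms .
  obtain b :: real where b: "0 < b" "b < 1" "1 < 2 * b ^ (k - 1) - b ^ (2 * k - 1)"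
    using exists_density_gain[OF assms(1)] .
  define g where "g = 2 * b ^ (k - 1) - b ^ (2 * k - 1)"
  \<comment> \<open>The midpoint of \<open>\<alpha>\<^sub>k / g\<close> and
    \<open>\<alpha>\<^sub>k\<close>: below the threshold, yet above it after multiplication by the
    gain \<open>g\<close>. In turn \<open>\<alpha>'\<close> lies midway between
    \<open>\<alpha>\<^sub>k\<close> and \<open>\<alpha> * g\<close>, which leaves a margin for
    concentration.\<close>
  define \<alpha> where "\<alpha> = \<alpha>\<^sub>k * (1 + 1 / g) / 2"
  define \<alpha>' where "\<alpha>' = (\<alpha>\<^sub>k + \<alpha> * g) / 2"
  define v where "v n = nat \<lfloor>b * real n\<rfloor>" for n
  define m where "m n = nat \<lfloor>\<alpha> * real n\<rfloor>" for n
  \<comment> \<open>This many clauses on the \<open>v n\<close> preferred variables have density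
    about \<open>\<alpha>'\<close>, above the threshold.\<close>
  define s where "s n = nat \<lfloor>\<alpha>' * real (v n)\<rfloor>" for n
  define p where "p n = 1 - (1 - real (v n choose k) / real (n choose k))\<^sup>2" for n
  have g: "1 < g"
    using b by (simp add: g_def)
  have \<alpha>: "0 < \<alpha>" "\<alpha> < \<alpha>\<^sub>k"
    using g pos by (auto simp: \<alpha>_def field_simps intro: add_pos_pos)
  have "\<alpha> * g = \<alpha>\<^sub>k * (g + 1) / 2"
    using g by (simp add: \<alpha>_def field_simps)
  moreover have "\<alpha>\<^sub>k * 1 < \<alpha>\<^sub>k * g"
    using g pos by (intro mult_strict_left_mono)
  ultimately have "\<alpha>\<^sub>k < \<alpha> * g"
    by (simp add: distrib_left)
  then have \<alpha>': "\<alpha>\<^sub>k < \<alpha>'" "\<alpha>' < \<alpha> * g"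
    by (auto simp: \<alpha>'_def)
  have v_le: "v n \<le> n" for n
  proof -
    have "b * real n \<le> real n"
      using b by (simp add: mult_left_le_one_le)
    then show ?thesis
      unfolding v_def by linarith
  qed
  have v_top: "filterlim v at_top sequentially"
    unfolding v_def using b by (intro filterlim_floor_mult)
  have m_top: "filterlim m at_top sequentially"
    unfolding m_def using \<alpha> by (intro filterlim_floor_mult)
  have p01: "0 \<le> p n \<and> p n \<le> 1" for n
  proof -
    have "real (v n choose k) / real (n choose k) \<le> (real (v n) / real n) ^ k"
      by (rule choose_ratio_le[OF v_le])
    also have "\<dots> \<le> 1"
      using v_le[of n] by (intro power_le_one) (auto simp: divide_le_eq_1)
    finally have "real (v n choose k) / real (n choose k) \<le> 1" .
    then show ?thesis
      by (auto simp: p_def power_le_one)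
  qed
  have "p \<longlonglongrightarrow> 1 - (1 - b ^ k)\<^sup>2"
    unfolding p_def v_def using b by (intro tendsto_intros tendsto_choose_ratio) auto
  also have "1 - (1 - b ^ k)\<^sup>2 = g * b"
  proof -
    have pows: "b ^ k = b ^ (k - 1) * b" "b ^ k * b ^ k = b ^ (2 * k - 1) * b"
      using assms(1) by (simp_all flip: power_Suc2 power_add mult_2)
    have "1 - (1 - b ^ k)\<^sup>2 = 2 * b ^ k - b ^ k * b ^ k"
      by (simp add: power2_eq_square algebra_simps)
    also have "\<dots> = 2 * (b ^ (k - 1) * b) - b ^ (2 * k - 1) * b"
      unfolding pows(2) using pows(1) by (rule arg_cong)
    also have "\<dots> = g * b"
      by (simp only: g_def left_diff_distrib mult.assoc)
    finally show ?thesis .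
  qed
  finally have p_lim: "p \<longlonglongrightarrow> g * b" .
  \<comment> \<open>The ratio factors as \<open>(s / v) * (v / n) / (m / n)\<close>. Its limit is
    below the limit \<open>g * b\<close> of \<open>p\<close> exactly because
    \<open>\<alpha>' < \<alpha> * g\<close>.\<close>
  have s_lim: "(\<lambda>n. real (s n) / real (m n)) \<longlonglongrightarrow> \<alpha>' * b / \<alpha>"
  proof -
    have "(\<lambda>n. real (s n) / real (v n)) \<longlonglongrightarrow> \<alpha>'"
      unfolding s_def using \<alpha>' pos
      by (intro filterlim_compose[OF tendsto_floor_mult_div v_top]) auto
    moreover have "(\<lambda>n. real (v n) / real n) \<longlonglongrightarrow> b" "(\<lambda>n. real (m n) / real n) \<longlonglongrightarrow> \<alpha>"
      unfolding v_def m_def using b \<alpha> by - (rule tendsto_floor_mult_div, simp)+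
    ultimately have "(\<lambda>n. real (s n) / real (v n) * (real (v n) / real n) / (real (m n) / real n))
        \<longlonglongrightarrow> \<alpha>' * b / \<alpha>"
      using \<alpha> by (intro tendsto_intros) auto
    moreover have "\<forall>\<^sub>F n in sequentially.
        real (s n) / real (v n) * (real (v n) / real n) / (real (m n) / real n)
        = real (s n) / real (m n)"
      using eventually_gt_at_top[of 0] eventually_compose_filterlim[OF eventually_gt_at_top[of 0] v_top]
      by eventually_elim simp
    ultimately show ?thesis
      by (rule Lim_transform_eventually)
  qed
  have binom: "(\<lambda>n. measure_pmf.prob (binomial_pmf (m n) (p n)) {s n..}) \<longlonglongrightarrow> 1"
    using \<alpha>' \<alpha> b
    by (intro binomial_concentration[OF p01 m_top p_lim s_lim]) (simp add: field_simps)
  have "(\<lambda>n. measure_pmf.prob (random_formula k n (nat \<lfloor>\<alpha>' * real n\<rfloor>)) {F. satisfiable F})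
      \<longlonglongrightarrow> 0"
    using assms(2) \<alpha>' pos by (simp add: is_sat_threshold_def)
  \<comment> \<open>The threshold property is applied along the numbers \<open>v n\<close> of
    variables, which tend to infinity.\<close>
  then have "(\<lambda>n. measure_pmf.prob (random_formula k (v n) (s n)) {F. satisfiable F}) \<longlonglongrightarrow> 0"
    unfolding s_def by (rule filterlim_compose[OF _ v_top])
  then have "(\<lambda>n. 1 - measure_pmf.prob (random_formula k (v n) (s n)) {F. satisfiable F})
      \<longlonglongrightarrow> 1 - 0"
    by (intro tendsto_intros)
  moreover have "1 - measure_pmf.prob M {F. satisfiable F} = measure_pmf.prob M {F. \<not> satisfiable F}"
    for M
    by (subst measure_pmf.prob_compl[symmetric]) (auto intro: arg_cong2[where f = measure])
  ultimately have unsat: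
    "(\<lambda>n. measure_pmf.prob (random_formula k (v n) (s n)) {F. \<not> satisfiable F}) \<longlonglongrightarrow> 1"
    by simp
  have "(\<lambda>n. measure_pmf.prob (achlioptas_formula 2 k n (prefer_inside k (v n)) (m n))
      {F. \<not> satisfiable F}) \<longlonglongrightarrow> 1"
  proof (rule tendsto_sandwich)
    show "(\<lambda>n. measure_pmf.prob (binomial_pmf (m n) (p n)) {s n..}
        * measure_pmf.prob (random_formula k (v n) (s n)) {F. \<not> satisfiable F}) \<longlonglongrightarrow> 1"
      using tendsto_mult[OF binom unsat] by simp
    show "\<forall>\<^sub>F n in sequentially. measure_pmf.prob (binomial_pmf (m n) (p n)) {s n..}
        * measure_pmf.prob (random_formula k (v n) (s n)) {F. \<not> satisfiable F}
        \<le> measure_pmf.prob (achlioptas_formula 2 k n (prefer_inside k (v n)) (m n)) {F. \<not> satisfiable F}"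
      using eventually_compose_filterlim[OF eventually_ge_at_top[of k] v_top] eventually_gt_at_top[of 0]
    proof eventually_elim
      case (elim n)
      have "real (v n) \<le> b * real n"
        using b by (simp add: v_def)
      also have "\<dots> < real n"
        using b elim by simp
      finally show ?case
        unfolding p_def using assms(1) elim by (intro prob_achlioptas_unsatisfiable_ge) auto
    qed
  qed auto
  then show ?thesis
    using \<alpha> is_strategy_prefer unfolding m_def
    by (intro exI[of _ \<alpha>] conjI exI[of _ "\<lambda>n. prefer_inside k (v n)"]) auto
qed

end
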